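(* Consider an algorithm state $(Q,C,A)$ in the random-correspondence model without failures on a multigraph $G$, with $d$ solutions at every vertex (all terms as defined in the context). Let $v$ be a vertex of $G$ and $e$ an edge incident to $v$. If $t$ is a candidate path track with $\mathrm{dest}(t)=v$ and $\mathrm{edge}(t)=\vec e$ (a direction of $e$ pointing into $v$), then $$\mathbf{E}_v(Q,C,A\cup\{t\}) = \mathbf{E}_v(Q,C,A) + \frac{d-\mathbf{E}_v(Q,C,A)}{d-|C_e|-\#\{t'\in A : \mathrm{edge}(t')=\vec e\}}.$$
   Context: Let $G$ be a finite loopless multigraph with vertex set $V$ and edge set $E$. Each vertex $v$ carries a set $S(v)$ of $d$ elements ("solutions"). Each edge $e$ connecting $v$ and $w$ induces a bijection between $S(v)$ and $S(w)$. Assumption: edges induce uniformly random correspondences, i.e. all bijections are equally likely, and bijections of different edges are independent. $\vec e$ denotes an edge $e$ with a chosen direction, with source $\mathrm{src}(\vec e)$ and destination $\mathrm{dest}(\vec e)$. An atomic task (path track) is a pair $t=(s,\vec e)$ with $s\in S(\mathrm{src}(\vec e))$; write $\mathrm{edge}(t)=\vec e$, $\mathrm{src}(t)=\mathrm{src}(\vec e)$, $\mathrm{dest}(t)=\mathrm{dest}(\vec e)$. Running $t$ to completion reveals the solution in $S(\mathrm{dest}(t))$ corresponding to $s$ under the bijection of $e$, and this solution becomes known. A state $(Q,C,A)$ consists of: - for each $v\in V$, a set $Q_v\subseteq S(v)$ of currently known solutions; - for each edge $e$ connecting $v$ and $w$, a partial one-to-one correspondence $C_e\subseteq Q_v\times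 Q_w$, the part of the bijection of $e$ known so far; - a finite set $A$ of distinct atomic tasks currently in progress; each $(s,\vec e)\in A$ has $s\in Q_{\mathrm{src}(\vec e)}$ and $s$ not in the projection of $C_e$ to $Q_{\mathrm{src}(\vec e)}$. A candidate path track is a task $t=(s,\vec e)\notin A$ with $s\in Q_{\mathrm{src}(\vec e)}$ and $s$ not in the projection of $C_e$ to $Q_{\mathrm{src}(\vec e)}$. All probabilities are conditional on the idle state $(Q,C,\emptyset)$: independently over edges $e$, the bijection of $e$ is uniform among all bijections extending $C_e$. $\mathbf{E}_v(Q,C,A)$ is the expected number of known solutions at $v$ after all tasks in $A$ have been run to completion, i.e. the expected cardinality of the union of $Q_v$ with the set of solutions found by those tasks in $A$ whose destination is $v$. *)

theory Defs
  imports "HOL-Probability.Probability" "Graph_Theory.Digraph"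
begin

text \<open>
  A finite loopless multigraph is a finite \<^locale>\<open>loopfree_digraph\<close>: each arc stands for one
  undirected edge, and its tail and head only fix an arbitrary reference orientation.  Parallel arcs
  are allowed.  An edge with a chosen direction is either the reference orientation or its reverse.
\<close>

datatype 'e directed = Forward (undirected: 'e) | Backward (undirected: 'e)

fun dsrc :: "('v, 'e) pre_digraph \<Rightarrow> 'e directed \<Rightarrow> 'v" where
  "dsrc G (Forward e) = tail G e"
| "dsrc G (Backward e) = head G e"

fun ddest :: "('v, 'e) pre_digraph \<Rightarrow> 'e directed \<Rightarrow> 'v" where
  "ddest G (Forward e) = head G e"
| "ddest G (Backward e) = tail G e"

definition solution_sets :: "('v, 'e) pre_digraph \<Rightarrow> ('v \<Rightarrow> 's set) \<Rightarrow> nat \<Rightarrow> bool" where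
  "solution_sets G S d \<longleftrightarrow> (\<forall>v\<in>verts G. finite (S v) \<and> card (S v) = d)"

type_synonym ('s, 'e) task = "'s \<times> 'e directed"

abbreviation task_edge :: "('s, 'e) task \<Rightarrow> 'e directed" where
  "task_edge t \<equiv> snd t"

abbreviation task_src :: "('v, 'e) pre_digraph \<Rightarrow> ('s, 'e) task \<Rightarrow> 'v" where
  "task_src G t \<equiv> dsrc G (task_edge t)"

abbreviation task_dest :: "('v, 'e) pre_digraph \<Rightarrow> ('s, 'e) task \<Rightarrow> 'v" where
  "task_dest G t \<equiv> ddest G (task_edge t)"

text \<open>
  \<open>C e\<close> is a subset of \<open>Q (tail G e) \<times> Q (head G e)\<close>; this is its projection to the solutions at the
  source of a directed edge.
\<close>

fun src_projection :: "('e \<Rightarrow> ('s \<times> 's) set) \<Rightarrow> 'e directed \<Rightarrow> 's set" where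
  "src_projection C (Forward e) = Domain (C e)"
| "src_projection C (Backward e) = Range (C e)"

text \<open>A task that may be run: its start solution is known, its result is not recorded in \<open>C\<close>.\<close>

definition open_task ::
  "('v, 'e) pre_digraph \<Rightarrow> ('v \<Rightarrow> 's set) \<Rightarrow> ('e \<Rightarrow> ('s \<times> 's) set) \<Rightarrow> ('s, 'e) task \<Rightarrow> bool" where
  "open_task G Q C t \<longleftrightarrow>
     undirected (task_edge t) \<in> arcs G \<and> fst t \<in> Q (task_src G t) \<and>
     fst t \<notin> src_projection C (task_edge t)"

definition is_state ::
  "('v, 'e) pre_digraph \<Rightarrow> ('v \<Rightarrow> 's set) \<Rightarrow>
   ('v \<Rightarrow> 's set) \<Rightarrow> ('e \<Rightarrow> ('s \<times> 's) set) \<Rightarrow> ('s, 'e) task set \<Rightarrow> bool" where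
  "is_state G S Q C A \<longleftrightarrow>
     (\<forall>v\<in>verts G. Q v \<subseteq> S v) \<and>
     (\<forall>e\<in>arcs G. C e \<subseteq> Q (tail G e) \<times> Q (head G e) \<and>
        single_valued (C e) \<and> single_valued ((C e)\<inverse>)) \<and>
     finite A \<and> (\<forall>t\<in>A. open_task G Q C t)"

definition candidate ::
  "('v, 'e) pre_digraph \<Rightarrow> ('v \<Rightarrow> 's set) \<Rightarrow> ('e \<Rightarrow> ('s \<times> 's) set) \<Rightarrow>
   ('s, 'e) task set \<Rightarrow> ('s, 'e) task \<Rightarrow> bool" where
  "candidate G Q C A t \<longleftrightarrow> t \<notin> A \<and> open_task G Q C t"

text \<open>
  The bijection of an edge is a function from the solutions at its tail to those at its head,
  made extensional so that there are only finitely many.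
\<close>

definition bijections :: "('v, 'e) pre_digraph \<Rightarrow> ('v \<Rightarrow> 's set) \<Rightarrow> 'e \<Rightarrow> ('s \<Rightarrow> 's) set" where
  "bijections G S e =
     {f \<in> S (tail G e) \<rightarrow>\<^sub>E S (head G e). bij_betw f (S (tail G e)) (S (head G e))}"

definition extensions ::
  "('v, 'e) pre_digraph \<Rightarrow> ('v \<Rightarrow> 's set) \<Rightarrow> ('e \<Rightarrow> ('s \<times> 's) set) \<Rightarrow> 'e \<Rightarrow> ('s \<Rightarrow> 's) set" where
  "extensions G S C e = {f \<in> bijections G S e. \<forall>(x, y)\<in>C e. f x = y}"

definition random_correspondences ::
  "('v, 'e) pre_digraph \<Rightarrow> ('v \<Rightarrow> 's set) \<Rightarrow> ('e \<Rightarrow> 's \<Rightarrow> 's) pmf" where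
  "random_correspondences G S = Pi_pmf (arcs G) undefined (\<lambda>e. pmf_of_set (bijections G S e))"

text \<open>
  The law of the bijections given the idle state.  By \<open>cond_random_correspondences\<close> below this is
  \<^const>\<open>random_correspondences\<close> conditioned on the event that all bijections extend \<open>C\<close>.
\<close>

definition state_pmf ::
  "('v, 'e) pre_digraph \<Rightarrow> ('v \<Rightarrow> 's set) \<Rightarrow> ('e \<Rightarrow> ('s \<times> 's) set) \<Rightarrow> ('e \<Rightarrow> 's \<Rightarrow> 's) pmf" where
  "state_pmf G S C = Pi_pmf (arcs G) undefined (\<lambda>e. pmf_of_set (extensions G S C e))"

fun task_result ::
  "('v, 'e) pre_digraph \<Rightarrow> ('v \<Rightarrow> 's set) \<Rightarrow> ('e \<Rightarrow> 's \<Rightarrow> 's) \<Rightarrow> ('s, 'e) task \<Rightarrow> 's" where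
  "task_result G S \<phi> (s, Forward e) = \<phi> e s"
| "task_result G S \<phi> (s, Backward e) = inv_into (S (tail G e)) (\<phi> e) s"

definition known_after ::
  "('v, 'e) pre_digraph \<Rightarrow> ('v \<Rightarrow> 's set) \<Rightarrow> ('v \<Rightarrow> 's set) \<Rightarrow> ('s, 'e) task set \<Rightarrow>
   ('e \<Rightarrow> 's \<Rightarrow> 's) \<Rightarrow> 'v \<Rightarrow> 's set" where
  "known_after G S Q A \<phi> v = Q v \<union> task_result G S \<phi> ` {t \<in> A. task_dest G t = v}"

definition expected_known ::
  "('v, 'e) pre_digraph \<Rightarrow> ('v \<Rightarrow> 's set) \<Rightarrow> 'v \<Rightarrow>
   ('v \<Rightarrow> 's set) \<Rightarrow> ('e \<Rightarrow> ('s \<times> 's) set) \<Rightarrow> ('s, 'e) task set \<Rightarrow> real" where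
  "expected_known G S v Q C A =
     measure_pmf.expectation (state_pmf G S C) (\<lambda>\<phi>. real (card (known_after G S Q A \<phi> v)))"

lemma finite_bijections:
  assumes "fin_digraph G" "solution_sets G S d" "e \<in> arcs G"
  shows "finite (bijections G S e)"
proof -
  interpret fin_digraph G by fact
  show ?thesis
    using assms unfolding bijections_def solution_sets_def
    by (intro finite_subset[OF _ finite_PiE[of "S (tail G e)" "\<lambda>_. S (head G e)"]]) auto
qed

lemma extensions_nonempty:
  assumes "fin_digraph G" "solution_sets G S d" "is_state G S Q C A" "e \<in> arcs G"
  shows "extensions G S C e \<noteq> {}"
proof -
  interpret fin_digraph G by fact
  define T H D R where "T = S (tail G e)" and "H = S (head G e)"
    and "D = Domain (C e)" and "R = Range (C e)"
  have fin: "finite T" "finite H" "card T = card H"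
    using assms by (auto simp: solution_sets_def T_def H_def)
  have "C e \<subseteq> Q (tail G e) \<times> Q (head G e)" "Q (tail G e) \<subseteq> T" "Q (head G e) \<subseteq> H"
    and sv: "single_valued (C e)" "single_valued ((C e)\<inverse>)"
    using assms by (auto simp: is_state_def T_def H_def)
  then have sub: "D \<subseteq> T" "R \<subseteq> H"
    by (auto simp: D_def R_def)
  define g where "g x = (THE y. (x, y) \<in> C e)" for x
  have g: "g x = y" if "(x, y) \<in> C e" for x y
    unfolding g_def using that sv(1) by (blast dest: single_valuedD)
  have "inj_on g D"
    using sv(2) by (auto simp: inj_on_def D_def single_valued_def g)
  moreover have "g ` D = R"
    by (force simp: D_def R_def g)
  ultimately have bij_g: "bij_betw g D R"
    by (simp add: bij_betw_def)
  then have "card (T - D) = card (H - R)"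
    using fin sub by (simp add: card_Diff_subset finite_subset bij_betw_same_card)
  then obtain h where bij_h: "bij_betw h (T - D) (H - R)"
    using fin finite_same_card_bij[of "T - D" "H - R"] by auto
  define f where "f x = (if x \<in> T then if x \<in> D then g x else h x else undefined)" for x
  have "bij_betw f D R"
    using bij_g sub by (subst bij_betw_cong[where g = g]) (auto simp: f_def)
  moreover have "bij_betw f (T - D) (H - R)"
    using bij_h by (subst bij_betw_cong[where g = h]) (auto simp: f_def)
  ultimately have "bij_betw f (D \<union> (T - D)) (R \<union> (H - R))"
    by (rule bij_betw_combine) auto
  then have "bij_betw f T H"
    using sub by (simp add: Un_absorb1)
  moreover have "f \<in> extensional T"
    by (simp add: extensional_def f_def)
  moreover have "f x = y" if "(x, y) \<in> C e" for x y
    using that sub g by (auto simp: f_def D_def)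
  ultimately have "f \<in> extensions G S C e"
    by (auto simp: extensions_def bijections_def T_def H_def PiE_def dest: bij_betw_apply)
  then show ?thesis
    by blast
qed

lemma cond_random_correspondences:
  assumes "fin_digraph G" "solution_sets G S d" "is_state G S Q C A"
  shows "state_pmf G S C =
    cond_pmf (random_correspondences G S) {\<phi>. \<forall>e\<in>arcs G. \<forall>(x, y)\<in>C e. \<phi> e x = y}"
proof -
  interpret fin_digraph G by fact
  define X where "X = PiE_dflt (arcs G) undefined (bijections G S)"
  define Y where "Y = PiE_dflt (arcs G) undefined (extensions G S C)"
  define Z where "Z = {\<phi>. \<forall>e\<in>arcs G. \<forall>(x, y)\<in>C e. \<phi> e x = (y :: 'c)}"
  have sub: "extensions G S C e \<subseteq> bijections G S e" for e
    by (auto simp: extensions_def)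
  have ne: "extensions G S C e \<noteq> {}" "bijections G S e \<noteq> {}" if "e \<in> arcs G" for e
    using extensions_nonempty[OF assms that] sub by auto
  have fin: "finite (bijections G S e)" "finite (extensions G S C e)" if "e \<in> arcs G" for e
    using finite_bijections[OF assms(1,2) that] finite_subset[OF sub] by auto
  have X: "finite X" "X \<noteq> {}" and Y: "finite Y" "Y \<noteq> {}"
    unfolding X_def Y_def using ne fin by (auto intro!: finite_PiE_dflt)
  have XY: "X \<inter> Z = Y"
    by (auto simp: X_def Y_def Z_def PiE_dflt_def extensions_def)
  have r: "random_correspondences G S = pmf_of_set X"
    unfolding random_correspondences_def X_def using ne fin by (intro Pi_pmf_of_set) auto
  have s: "state_pmf G S C = pmf_of_set Y"
    unfolding state_pmf_def Y_def using ne fin by (intro Pi_pmf_of_set) auto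
  have cond: "set_pmf (pmf_of_set X) \<inter> Z \<noteq> {}"
    using X Y XY by simp
  have "pmf_of_set Y = cond_pmf (pmf_of_set X) Z"
  proof (rule pmf_eqI)
    fix \<phi>
    have "card X \<noteq> 0"
      using X by simp
    then show "pmf (pmf_of_set Y) \<phi> = pmf (cond_pmf (pmf_of_set X) Z) \<phi>"
      using X Y XY by (auto simp: pmf_cond[OF cond] measure_pmf_of_set indicator_def)
  qed
  then show ?thesis
    by (simp add: r s Z_def)
qed

end

theory Submission
  imports Defs
begin

text \<open>
  Let \<open>B\<close> be the set of solutions at the source of \<open>t\<close> whose images under the bijection of \<open>e\<close> are
  neither recorded in \<open>C\<close> nor computed by a task of \<open>A\<close> in the direction of \<open>t\<close>.  Exchanging two
  elements of \<open>B\<close> preserves the law of the bijections and the solutions known at \<open>v\<close> after \<open>A\<close>: as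
  there are no loops, tasks along the reverse of \<open>t\<close> do not end at \<open>v\<close>.  Hence the image of each
  element of \<open>B\<close> is new with the same probability.  Every solution at \<open>v\<close> still unknown after \<open>A\<close> is
  the image of exactly one element of \<open>B\<close>, so these probabilities add up to the expected number of
  unknown solutions.
\<close>

text \<open>For a backward edge the source is the head, so \<open>\<pi>\<close> acts on the values
  of \<open>f\<close>. The restriction to the tail set \<open>T\<close> then keeps the result
  extensional. In the forward case extensionality survives because the permutations used fix every
  point outside \<open>T\<close>.\<close>

fun permute_source :: "'s set \<Rightarrow> ('s \<Rightarrow> 's) \<Rightarrow> 'e directed \<Rightarrow> ('s \<Rightarrow> 's) \<Rightarrow> 's \<Rightarrow> 's" where
  "permute_source T \<pi> (Forward e) f = f \<circ> \<pi>"
| "permute_source T \<pi> (Backward e) f = restrict (\<pi> \<circ> f) T"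

section \<open>The finite sample space of bijections extending the recorded ones\<close>

locale correspondence_state = fin_digraph G for G :: "('v, 'e) pre_digraph" +
  fixes S Q :: "'v \<Rightarrow> 's set" and d :: nat
    and C :: "'e \<Rightarrow> ('s \<times> 's) set" and A :: "('s, 'e) task set"
  assumes sols: "solution_sets G S d" and state: "is_state G S Q C A"
begin

definition correspondences :: "('e \<Rightarrow> 's \<Rightarrow> 's) set" where
  "correspondences = PiE_dflt (arcs G) undefined (extensions G S C)"

definition permute_correspondence ::
    "('s \<Rightarrow> 's) \<Rightarrow> 'e directed \<Rightarrow> ('e \<Rightarrow> 's \<Rightarrow> 's) \<Rightarrow> 'e \<Rightarrow> 's \<Rightarrow> 's" where
  "permute_correspondence \<pi> de \<phi> = \<phi>(undirected de :=
     permute_source (S (tail G (undirected de))) \<pi> de (\<phi> (undirected de)))"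

lemma finite_solutions: "u \<in> verts G \<Longrightarrow> finite (S u)"
  and card_solutions: "u \<in> verts G \<Longrightarrow> card (S u) = d"
  and known_subset: "u \<in> verts G \<Longrightarrow> Q u \<subseteq> S u"
  and recorded_subset: "e \<in> arcs G \<Longrightarrow> C e \<subseteq> Q (tail G e) \<times> Q (head G e)"
  and open_tasks: "t \<in> A \<Longrightarrow> open_task G Q C t"
  using sols state by (auto simp: solution_sets_def is_state_def)

lemma dsrc_in_verts: "undirected de \<in> arcs G \<Longrightarrow> dsrc G de \<in> verts G"
  and ddest_in_verts: "undirected de \<in> arcs G \<Longrightarrow> ddest G de \<in> verts G"
  by (cases de; simp)+

lemma finite_extensions: "e \<in> arcs G \<Longrightarrow> finite (extensions G S C e)"
  by (rule finite_subset[OF _ finite_bijections[OF fin_digraph_axioms sols]])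
    (auto simp: extensions_def)

lemma finite_correspondences: "finite correspondences"
  unfolding correspondences_def using finite_extensions by (auto intro!: finite_PiE_dflt)

lemma correspondences_nonempty: "correspondences \<noteq> {}"
  unfolding correspondences_def
  using extensions_nonempty[OF fin_digraph_axioms sols state] by auto

text \<open>A product of uniform laws on finite nonempty sets is uniform on the product. Invariance
  of the law thus reduces to bijectivity on \<open>correspondences\<close>.\<close>

lemma state_pmf_eq: "state_pmf G S C = pmf_of_set correspondences"
  unfolding state_pmf_def correspondences_def
  using finite_extensions extensions_nonempty[OF fin_digraph_axioms sols state]
  by (intro Pi_pmf_of_set) auto

lemma set_state_pmf: "set_pmf (state_pmf G S C) = correspondences"
  using finite_correspondences correspondences_nonempty by (simp add: state_pmf_eq)

lemma integrable_state_pmf [simp]: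
  "integrable (measure_pmf (state_pmf G S C)) (f :: _ \<Rightarrow> real)"
  by (rule integrable_measure_pmf_finite) (simp add: set_state_pmf finite_correspondences)

lemma correspondence_bij:
  "\<phi> \<in> correspondences \<Longrightarrow> e \<in> arcs G \<Longrightarrow> bij_betw (\<phi> e) (S (tail G e)) (S (head G e))"
  by (auto simp: correspondences_def PiE_dflt_def extensions_def bijections_def)

lemma correspondence_recorded:
  "\<phi> \<in> correspondences \<Longrightarrow> e \<in> arcs G \<Longrightarrow> (x, y) \<in> C e \<Longrightarrow> \<phi> e x = y"
  by (auto simp: correspondences_def PiE_dflt_def extensions_def)

lemma task_result_bij:
  assumes "\<phi> \<in> correspondences" "undirected de \<in> arcs G"
  shows "bij_betw (\<lambda>x. task_result G S \<phi> (x, de)) (S (dsrc G de)) (S (ddest G de))"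
  using correspondence_bij[OF assms]
  by (cases de) (auto intro: bij_betw_inv_into)

lemma task_result_recorded:
  assumes "\<phi> \<in> correspondences" "undirected de \<in> arcs G" "x \<in> src_projection C de"
  shows "task_result G S \<phi> (x, de) \<in> Q (ddest G de)"
proof (cases de)
  case (Forward e)
  then obtain y where y: "(x, y) \<in> C e"
    using assms by auto
  then show ?thesis
    using Forward assms correspondence_recorded[OF assms(1) _ y] recorded_subset[of e] by auto
next
  case (Backward e)
  then obtain y where y: "(y, x) \<in> C e"
    using assms by auto
  have e: "e \<in> arcs G"
    using assms Backward by simp
  then have "y \<in> Q (tail G e)" "y \<in> S (tail G e)"
    using y recorded_subset known_subset[of "tail G e"] by auto
  \<comment> \<open>Injectivity of \<open>\<phi> e\<close> makes the recorded partner
    \<open>y\<close> the only preimage of \<open>x\<close>.\<close>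
  moreover have "inv_into (S (tail G e)) (\<phi> e) x = y"
    using correspondence_bij[OF assms(1) e] correspondence_recorded[OF assms(1) e y] calculation
    by (auto intro: inv_into_f_eq simp: bij_betw_def)
  ultimately show ?thesis
    using Backward by simp
qed

lemma src_projection_subset:
  assumes "undirected de \<in> arcs G"
  shows "src_projection C de \<subseteq> Q (dsrc G de)"
  using assms recorded_subset[OF assms] by (cases de) auto

text \<open>Single-valuedness in both directions lets either coordinate determine a recorded
  pair.\<close>

lemma card_src_projection:
  assumes "undirected de \<in> arcs G"
  shows "card (src_projection C de) = card (C (undirected de))"
proof -
  have sv: "single_valued (C (undirected de))" "single_valued ((C (undirected de))\<inverse>)"
    using assms state by (auto simp: is_state_def)
  then have "inj_on fst (C (undirected de))" "inj_on snd (C (undirected de))"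
    by (auto simp: inj_on_def single_valued_def)
  then show ?thesis
    by (cases de) (simp_all add: Domain_fst Range_snd card_image)
qed

section \<open>Invariance of the law under permutations at the source of an edge\<close>

lemma permute_source_extension:
  assumes e: "undirected de \<in> arcs G" and f: "f \<in> extensions G S C (undirected de)"
    and \<pi>: "\<pi> permutes S (dsrc G de) - src_projection C de"
  shows "permute_source (S (tail G (undirected de))) \<pi> de f \<in> extensions G S C (undirected de)"
proof -
  have \<pi>_S: "\<pi> permutes S (dsrc G de)"
    by (rule permutes_subset[OF \<pi>]) auto
  \<comment> \<open>Recorded pairs survive the permutation because their source ends lie outside its
    support.\<close>
  have fixed: "\<pi> x = x" if "x \<in> src_projection C de" for x
    using permutes_not_in[OF \<pi>] that by auto
  show ?thesis
  proof (cases de)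
    case (Forward e)
    then have f: "bij_betw f (S (tail G e)) (S (head G e))" "f \<in> extensional (S (tail G e))"
        "\<And>x y. (x, y) \<in> C e \<Longrightarrow> f x = y"
      using f by (auto simp: extensions_def bijections_def PiE_def)
    have "bij_betw (f \<circ> \<pi>) (S (tail G e)) (S (head G e))"
      using f(1) permutes_imp_bij[OF \<pi>_S] Forward by (auto intro: bij_betw_trans)
    moreover have "f \<circ> \<pi> \<in> extensional (S (tail G e))"
      using f(2) permutes_not_in[OF \<pi>_S] Forward by (auto simp: extensional_def)
    moreover have "(f \<circ> \<pi>) x = y" if xy: "(x, y) \<in> C e" for x y
    proof -
      have "\<pi> x = x"
        using fixed[of x] xy Forward by auto
      then show ?thesis
        using f(3)[OF xy] by simp
    qed
    ultimately show ?thesis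
      using Forward by (auto simp: extensions_def bijections_def PiE_def dest: bij_betw_apply)
  next
    case (Backward e)
    then have f: "bij_betw f (S (tail G e)) (S (head G e))"
        "\<And>x y. (x, y) \<in> C e \<Longrightarrow> f x = y"
      using f by (auto simp: extensions_def bijections_def)
    have "bij_betw (\<pi> \<circ> f) (S (tail G e)) (S (head G e))"
      using f(1) permutes_imp_bij[OF \<pi>_S] Backward by (auto intro: bij_betw_trans)
    then have bij: "bij_betw (restrict (\<pi> \<circ> f) (S (tail G e))) (S (tail G e)) (S (head G e))"
      by (simp cong: bij_betw_cong)
    moreover have "restrict (\<pi> \<circ> f) (S (tail G e)) x = y" if xy: "(x, y) \<in> C e" for x y
    proof -
      have "x \<in> S (tail G e)"
        using xy recorded_subset[of e] known_subset[of "tail G e"] assms(1) Backward by auto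
      moreover have "\<pi> y = y"
        using fixed[of y] xy Backward by auto
      ultimately show ?thesis
        using f(2)[OF xy] by simp
    qed
    ultimately show ?thesis
      using Backward bij_betw_apply[OF bij] by (auto simp: extensions_def bijections_def)
  qed
qed

text \<open>On \<open>T\<close> the two copies of \<open>\<pi>\<close> cancel. In the backward case
  both sides are \<open>undefined\<close> off \<open>T\<close>, since \<open>f\<close> is
  extensional.\<close>

lemma permute_source_involution:
  assumes "f \<in> extensions G S C (undirected de)" and "\<And>x. \<pi> (\<pi> x) = x"
  defines "T \<equiv> S (tail G (undirected de))"
  shows "permute_source T \<pi> de (permute_source T \<pi> de f) = f"
  using assms
  by (cases de) (auto simp: fun_eq_iff extensions_def bijections_def PiE_def extensional_def)

lemma permute_correspondence_in:
  assumes "\<phi> \<in> correspondences" "undirected de \<in> arcs G"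
    and "\<pi> permutes S (dsrc G de) - src_projection C de"
  shows "permute_correspondence \<pi> de \<phi> \<in> correspondences"
  using assms permute_source_extension[of de "\<phi> (undirected de)" \<pi>]
  by (auto simp: correspondences_def PiE_dflt_def permute_correspondence_def)

text \<open>Being its own inverse, the map is a bijection of the sample space onto itself, and a
  uniform law is invariant under such a map.\<close>

lemma map_permute_correspondence:
  assumes e: "undirected de \<in> arcs G"
    and \<pi>: "\<pi> permutes S (dsrc G de) - src_projection C de" "\<And>x. \<pi> (\<pi> x) = x"
  shows "map_pmf (permute_correspondence \<pi> de) (state_pmf G S C) = state_pmf G S C"
proof -
  have "bij_betw (permute_correspondence \<pi> de) correspondences correspondences"
  proof (rule bij_betw_byWitness[where f' = "permute_correspondence \<pi> de"])
    have "permute_correspondence \<pi> de (permute_correspondence \<pi> de \<phi>) = \<phi>"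
      if "\<phi> \<in> correspondences" for \<phi>
      using that e permute_source_involution[OF _ \<pi>(2), of "\<phi> (undirected de)" de]
      by (auto simp: permute_correspondence_def correspondences_def PiE_dflt_def)
    then show "\<forall>\<phi>\<in>correspondences.
        permute_correspondence \<pi> de (permute_correspondence \<pi> de \<phi>) = \<phi>"
      and "\<forall>\<phi>\<in>correspondences.
        permute_correspondence \<pi> de (permute_correspondence \<pi> de \<phi>) = \<phi>"
      by auto
  qed (use permute_correspondence_in[OF _ e \<pi>(1)] in auto)
  then show ?thesis
    unfolding state_pmf_eq
    by (intro map_pmf_of_set_bij_betw correspondences_nonempty finite_correspondences)
qed

text \<open>Forwards this is the definition of composition. Backwards, the preimage of
  \<open>x\<close> under \<pi> after \<open>\<phi> e\<close> is the preimage of the inverse image of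
  \<open>x\<close> under \<pi>, and that inverse image is \<open>\<pi> x\<close> for an involution.
  So one formula serves both directions.\<close>

lemma task_result_permute:
  assumes \<phi>: "\<phi> \<in> correspondences" and e: "undirected de \<in> arcs G"
    and \<pi>: "\<pi> permutes S (dsrc G de)" "\<And>x. \<pi> (\<pi> x) = x" and x: "x \<in> S (dsrc G de)"
  shows "task_result G S (permute_correspondence \<pi> de \<phi>) (x, de) = task_result G S \<phi> (\<pi> x, de)"
proof (cases de)
  case (Forward e)
  then show ?thesis
    by (simp add: permute_correspondence_def)
next
  case (Backward e)
  then have e: "e \<in> arcs G" and \<pi>x: "\<pi> x \<in> S (head G e)"
    using e x permutes_in_image[OF \<pi>(1)] by auto
  define T where "T = S (tail G e)"
  define y where "y = inv_into T (\<phi> e) (\<pi> x)"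
  have bij: "bij_betw (\<phi> e) T (S (head G e))"
    unfolding T_def using correspondence_bij[OF \<phi> e] .
  then have y: "y \<in> T" "\<phi> e y = \<pi> x"
    using \<pi>x unfolding y_def by (auto simp: bij_betw_def inv_into_into f_inv_into_f)
  have "inj \<pi>"
    using \<pi>(1) by (rule permutes_inj)
  then have "inj_on (restrict (\<pi> \<circ> \<phi> e) T) T"
    using bij by (auto simp: inj_on_def bij_betw_def)
  then have "inv_into T (restrict (\<pi> \<circ> \<phi> e) T) x = y"
    using y \<pi>(2) by (intro inv_into_f_eq) auto
  then show ?thesis
    using Backward by (simp add: permute_correspondence_def T_def y_def)
qed

lemma task_result_permute_other:
  assumes "undirected (task_edge t) \<noteq> undirected de"
  shows "task_result G S (permute_correspondence \<pi> de \<phi>) t = task_result G S \<phi> t"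
  using assms by (cases "(G, S, \<phi>, t)" rule: task_result.cases)
    (auto simp: permute_correspondence_def)

section \<open>Solutions whose images are not yet determined\<close>

definition undetermined :: "'e directed \<Rightarrow> 's set" where
  "undetermined de = S (dsrc G de) - src_projection C de - {x. (x, de) \<in> A}"

lemma determined_subset:
  assumes "undirected de \<in> arcs G"
  shows "src_projection C de \<union> {x. (x, de) \<in> A} \<subseteq> S (dsrc G de)"
  using src_projection_subset[OF assms] known_subset[OF dsrc_in_verts[OF assms]] open_tasks
  by (fastforce simp: open_task_def)

lemma finite_undetermined: "undirected de \<in> arcs G \<Longrightarrow> finite (undetermined de)"
  using finite_solutions[OF dsrc_in_verts] by (simp add: undetermined_def)

text \<open>Tasks of \<open>A\<close> are open, so their start solutions along \<open>de\<close> are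
  disjoint from the recorded ones and the two counts subtract separately. This produces the
  denominator of the formula.\<close>

lemma card_undetermined:
  assumes "undirected de \<in> arcs G"
  shows "real (card (undetermined de)) =
    real d - real (card (C (undirected de))) - real (card {t' \<in> A. task_edge t' = de})"
proof -
  let ?T = "{x. (x, de) \<in> A}" and ?U = "S (dsrc G de)"
  have finU: "finite ?U" and cardU: "card ?U = d"
    using finite_solutions card_solutions dsrc_in_verts[OF assms] by auto
  have fin: "finite (src_projection C de)" "finite ?T"
    using determined_subset[OF assms] finU by (auto intro: finite_subset)
  have "{t' \<in> A. task_edge t' = de} = (\<lambda>x. (x, de)) ` ?T"
    by (auto simp: image_iff)
  then have T: "card {t' \<in> A. task_edge t' = de} = card ?T"
    by (simp add: card_image inj_on_def)
  have "src_projection C de \<inter> ?T = {}"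
    using open_tasks by (force simp: open_task_def)
  then have "card (src_projection C de \<union> ?T) = card (src_projection C de) + card ?T"
    using fin by (simp add: card_Un_disjoint)
  moreover have "undetermined de = ?U - (src_projection C de \<union> ?T)"
    by (auto simp: undetermined_def)
  moreover have "card (src_projection C de \<union> ?T) \<le> card ?U"
    using determined_subset[OF assms] finU by (intro card_mono)
  ultimately show ?thesis
    using determined_subset[OF assms] fin cardU T card_src_projection[OF assms]
    by (simp add: card_Diff_subset)
qed

lemma known_after_subset:
  assumes "\<phi> \<in> correspondences" "u \<in> verts G"
  shows "known_after G S Q A \<phi> u \<subseteq> S u"
proof -
  have "task_result G S \<phi> (x, de) \<in> S (ddest G de)" if "(x, de) \<in> A" for x de
  proof -
    have "open_task G Q C (x, de)"
      using open_tasks that .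
    then have "undirected de \<in> arcs G" "x \<in> S (dsrc G de)"
      using known_subset[OF dsrc_in_verts] by (auto simp: open_task_def)
    then show ?thesis
      using bij_betw_apply[OF task_result_bij[OF assms(1)]] by blast
  qed
  then show ?thesis
    using known_subset[OF assms(2)] by (auto simp: known_after_def)
qed

lemma finite_known_after:
  "\<phi> \<in> correspondences \<Longrightarrow> u \<in> verts G \<Longrightarrow> finite (known_after G S Q A \<phi> u)"
  by (rule finite_subset[OF known_after_subset finite_solutions])

lemma sum_new_results:
  assumes \<phi>: "\<phi> \<in> correspondences" and e: "undirected de \<in> arcs G"
  defines "K \<equiv> known_after G S Q A \<phi> (ddest G de)"
  shows "(\<Sum>x\<in>undetermined de. of_bool (task_result G S \<phi> (x, de) \<notin> K)) =
    real d - real (card K)"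
proof -
  let ?R = "\<lambda>x. task_result G S \<phi> (x, de)" and ?N = "{x \<in> undetermined de.
    task_result G S \<phi> (x, de) \<notin> K}"
  have v: "ddest G de \<in> verts G"
    using ddest_in_verts[OF e] .
  have bij: "bij_betw ?R (S (dsrc G de)) (S (ddest G de))"
    using task_result_bij[OF \<phi> e] .
  \<comment> \<open>A recorded start solution leads into \<open>Q\<close>, and one used by
    \<open>A\<close> leads to a result of \<open>A\<close>. Hence the preimage of a solution outside
    \<open>K\<close> must lie in \<open>undetermined de\<close>.\<close>
  have K: "?R x \<in> K" if "x \<in> src_projection C de \<or> (x, de) \<in> A" for x
    using that task_result_recorded[OF \<phi> e, of x] by (auto simp: K_def known_after_def)
  have "?R ` ?N = S (ddest G de) - K"
  proof (intro equalityI subsetI)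
    fix y assume "y \<in> S (ddest G de) - K"
    moreover from this obtain x where "x \<in> S (dsrc G de)" "y = ?R x"
      using bij by (auto simp: bij_betw_def)
    ultimately show "y \<in> ?R ` ?N"
      using K[of x] by (auto simp: undetermined_def)
  qed (use bij_betw_apply[OF bij] in \<open>auto simp: undetermined_def\<close>)
  moreover have "card (?R ` ?N) = card ?N"
    by (rule card_image, rule inj_on_subset[OF bij_betw_imp_inj_on[OF bij]]) (auto simp: undetermined_def)
  ultimately have "card ?N = card (S (ddest G de) - K)"
    by simp
  moreover have "K \<subseteq> S (ddest G de)" "finite K"
    unfolding K_def using known_after_subset[OF \<phi> v] finite_known_after[OF \<phi> v] .
  \<comment> \<open>The bound from \<open>card_mono\<close> rules out truncation in the difference
    of natural numbers.\<close>
  ultimately have "real (card ?N) = real d - real (card K)"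
    using card_solutions[OF v] card_mono[OF finite_solutions[OF v], of K]
    by (simp add: card_Diff_subset)
  moreover have "(\<Sum>x\<in>undetermined de. of_bool (?R x \<notin> K)) = real (card ?N)"
    using finite_undetermined[OF e] by (simp add: sum_of_bool_eq Int_def)
  ultimately show ?thesis
    by simp
qed

lemma known_after_permute:
  assumes \<phi>: "\<phi> \<in> correspondences" and e: "undirected de \<in> arcs G"
    and loop: "tail G (undirected de) \<noteq> head G (undirected de)"
    and \<pi>: "\<pi> permutes undetermined de" "\<And>x. \<pi> (\<pi> x) = x"
  shows "known_after G S Q A (permute_correspondence \<pi> de \<phi>) (ddest G de) =
    known_after G S Q A \<phi> (ddest G de)"
proof -
  have "task_result G S (permute_correspondence \<pi> de \<phi>) t = task_result G S \<phi> t"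
    if t: "t \<in> A" "task_dest G t = ddest G de" for t
  \<comment> \<open>On the same edge, the common destination forces the same direction because the
    two ends differ. The start solution of such a task is outside the support of \<pi>. On any other
    edge nothing has changed.\<close>
  proof (cases "undirected (task_edge t) = undirected de")
    case True
    then have "task_edge t = de"
      using t(2) loop by (cases "task_edge t"; cases de) auto
    then obtain x where tx: "t = (x, de)"
      by (cases t) auto
    then have "\<pi> x = x" "x \<in> S (dsrc G de)"
      using t(1) determined_subset[OF e] permutes_not_in[OF \<pi>(1)]
      by (auto simp: undetermined_def)
    moreover have "\<pi> permutes S (dsrc G de)"
      by (rule permutes_subset[OF \<pi>(1)]) (auto simp: undetermined_def)
    ultimately show ?thesis
      using task_result_permute[OF \<phi> e _ \<pi>(2), of x] tx by simp
  qed (rule task_result_permute_other)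
  then show ?thesis
    unfolding known_after_def by (auto simp: image_iff)
qed

section \<open>The probability that a task finds a new solution\<close>

definition new_result_prob :: "'e directed \<Rightarrow> 's \<Rightarrow> real" where
  "new_result_prob de x = measure_pmf.expectation (state_pmf G S C)
     (\<lambda>\<phi>. of_bool (task_result G S \<phi> (x, de) \<notin> known_after G S Q A \<phi> (ddest G de)))"

lemma new_result_prob_eq:
  assumes e: "undirected de \<in> arcs G" and loop: "tail G (undirected de) \<noteq> head G (undirected de)"
    and x: "x \<in> undetermined de" and y: "y \<in> undetermined de"
  shows "new_result_prob de x = new_result_prob de y"
proof -
  \<comment> \<open>A transposition is an involution, and this one moves only elements of
    \<open>undetermined de\<close>, so it satisfies the hypotheses of both invariance
    lemmas.\<close>
  define \<pi> where "\<pi> = Transposition.transpose x y"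
  have \<pi>: "\<pi> permutes undetermined de" "\<And>z. \<pi> (\<pi> z) = z"
    unfolding \<pi>_def using x y by (auto intro: permutes_swap_id)
  have \<pi>_sub: "\<pi> permutes S (dsrc G de) - src_projection C de" "\<pi> permutes S (dsrc G de)"
    by (rule permutes_subset[OF \<pi>(1)]; auto simp: undetermined_def)+
  have "new_result_prob de x =
      measure_pmf.expectation (map_pmf (permute_correspondence \<pi> de) (state_pmf G S C))
        (\<lambda>\<phi>. of_bool (task_result G S \<phi> (x, de) \<notin> known_after G S Q A \<phi> (ddest G de)))"
    unfolding new_result_prob_def map_permute_correspondence[OF e \<pi>_sub(1) \<pi>(2)] ..
  \<comment> \<open>After the change of variables the result of the task at \<open>x\<close> becomes
    that of the task at \<open>y\<close>, while the known set at the destination stays the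
    same.\<close>
  also have "\<dots> = new_result_prob de y"
    unfolding new_result_prob_def integral_map_pmf
  proof (intro integral_cong_AE AE_pmfI)
    fix \<phi> assume "\<phi> \<in> set_pmf (state_pmf G S C)"
    then have \<phi>: "\<phi> \<in> correspondences"
      by (simp add: set_state_pmf)
    have "x \<in> S (dsrc G de)"
      using x by (simp add: undetermined_def)
    then have "task_result G S (permute_correspondence \<pi> de \<phi>) (x, de) = task_result G S \<phi> (y, de)"
      using task_result_permute[OF \<phi> e \<pi>_sub(2) \<pi>(2)] by (simp add: \<pi>_def)
    then show "of_bool (task_result G S (permute_correspondence \<pi> de \<phi>) (x, de)
          \<notin> known_after G S Q A (permute_correspondence \<pi> de \<phi>) (ddest G de)) =
        (of_bool (task_result G S \<phi> (y, de) \<notin> known_after G S Q A \<phi> (ddest G de)) :: real)"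
      using known_after_permute[OF \<phi> e loop \<pi>] by simp
  qed simp_all
  finally show ?thesis .
qed

text \<open>Linearity of expectation applied to the pointwise count
  \<open>sum_new_results\<close>.\<close>

lemma sum_new_result_prob:
  assumes e: "undirected de \<in> arcs G"
  shows "(\<Sum>x\<in>undetermined de. new_result_prob de x) =
    real d - expected_known G S (ddest G de) Q C A"
proof -
  have "(\<Sum>x\<in>undetermined de. new_result_prob de x) =
      measure_pmf.expectation (state_pmf G S C) (\<lambda>\<phi>. \<Sum>x\<in>undetermined de.
        of_bool (task_result G S \<phi> (x, de) \<notin> known_after G S Q A \<phi> (ddest G de)))"
    unfolding new_result_prob_def by (rule Bochner_Integration.integral_sum[symmetric]) simp
  also have "\<dots> = measure_pmf.expectation (state_pmf G S C)
      (\<lambda>\<phi>. real d - real (card (known_after G S Q A \<phi> (ddest G de))))"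
    by (intro integral_cong_AE AE_pmfI) (simp_all add: set_state_pmf sum_new_results e)
  also have "\<dots> = real d - expected_known G S (ddest G de) Q C A"
    by (simp add: expected_known_def)
  finally show ?thesis .
qed

text \<open>The extra task inserts a single element into the known set, so the cardinality grows by
  the indicator of a new result.\<close>

lemma expected_known_insert:
  assumes e: "undirected de \<in> arcs G"
  shows "expected_known G S (ddest G de) Q C (A \<union> {(x, de)}) =
    expected_known G S (ddest G de) Q C A + new_result_prob de x"
proof -
  have v: "ddest G de \<in> verts G"
    using ddest_in_verts[OF e] .
  have "known_after G S Q (A \<union> {(x, de)}) \<phi> (ddest G de) =
      insert (task_result G S \<phi> (x, de)) (known_after G S Q A \<phi> (ddest G de))" for \<phi>
    by (auto simp: known_after_def)
  then have "expected_known G S (ddest G de) Q C (A \<union> {(x, de)}) =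
      measure_pmf.expectation (state_pmf G S C)
        (\<lambda>\<phi>. real (card (known_after G S Q A \<phi> (ddest G de))) +
          of_bool (task_result G S \<phi> (x, de) \<notin> known_after G S Q A \<phi> (ddest G de)))"
    unfolding expected_known_def
    by (intro integral_cong_AE AE_pmfI)
      (simp_all add: set_state_pmf finite_known_after v card_insert_if)
  then show ?thesis
    by (simp add: expected_known_def new_result_prob_def)
qed

end

theorem proposition1:
  fixes G :: "('v, 'e) pre_digraph" and S Q :: "'v \<Rightarrow> 's set" and d :: nat
    and C :: "'e \<Rightarrow> ('s \<times> 's) set" and A :: "('s, 'e) task set" and t :: "('s, 'e) task"
    and v :: 'v and e :: 'e and de :: "'e directed"
  assumes "fin_digraph G" and "loopfree_digraph G"
    and "solution_sets G S d"
    and "is_state G S Q C A"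
    and "v \<in> verts G" and "e \<in> arcs G" and "v \<in> {tail G e, head G e}"
    and "candidate G Q C A t"
    and "task_dest G t = v" and "task_edge t = de" and "undirected de = e"
  shows "expected_known G S v Q C (A \<union> {t}) =
    expected_known G S v Q C A +
      (real d - expected_known G S v Q C A) /
      (real d - real (card (C e)) - real (card {t' \<in> A. task_edge t' = de}))"
proof -
  interpret fin_digraph G by fact
  interpret loopfree_digraph G by fact
  interpret correspondence_state G S Q d C A
    by unfold_locales fact+
  obtain x where t: "t = (x, de)"
    using assms by (cases t) auto
  have e: "undirected de \<in> arcs G" and v: "v = ddest G de"
    using assms t by auto
  have loop: "tail G (undirected de) \<noteq> head G (undirected de)"
    using no_loops e by blast
  have "open_task G Q C (x, de)" "(x, de) \<notin> A"
    using assms t by (auto simp: candidate_def)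
  \<comment> \<open>Being a candidate excludes both ways of being determined. This membership also
    makes the set nonempty, which justifies the later division by its cardinality.\<close>
  then have x: "x \<in> undetermined de"
    using known_subset[OF dsrc_in_verts[OF e]] by (auto simp: undetermined_def open_task_def)
  have "real d - expected_known G S v Q C A = (\<Sum>y\<in>undetermined de. new_result_prob de y)"
    unfolding v using sum_new_result_prob[OF e] by simp
  \<comment> \<open>By symmetry each summand equals the one at the start solution of
    \<open>t\<close>.\<close>
  also have "\<dots> = (\<Sum>y\<in>undetermined de. new_result_prob de x)"
    using new_result_prob_eq[OF e loop _ x] by (intro sum.cong) auto
  also have "\<dots> = real (card (undetermined de)) * new_result_prob de x"
    by simp
  finally have "new_result_prob de x =
      (real d - expected_known G S v Q C A) / real (card (undetermined de))"
    using x finite_undetermined[OF e] by (auto simp: field_simps)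
  moreover have "expected_known G S v Q C (A \<union> {t}) =
      expected_known G S v Q C A + new_result_prob de x"
    unfolding v t using expected_known_insert[OF e] .
  ultimately show ?thesis
    using card_undetermined[OF e] assms by simp
qed

end
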